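(* Let $T=(Q,q_0,\Omega,S,\Delta,\lambda)$ be a fiber-linear graph-respecting transducer. Then there exists an injectively labeled symbolic DLSL system with dwell $\mathcal A_T=(S,E,\ell,s_0,d,(g_i)_{i\in S})$ such that the phase-expanded realization of $\mathcal A_T$ is isomorphic to $T$. Moreover, $\mathcal A_T$ is unique up to injective relabeling of the visible states.
   Context: Visible graphs. $S$ is a finite set (visible states), $\Omega$ a finite input alphabet. For a directed graph $(S,E)$, $E\subseteq S\times S$, write $\mathrm{Out}(i)=\{j\in S:(i,j)\in E\}$. With a labeling $\ell:S\to\Sigma$ into a finite alphabet the graph is destination-labeled: each edge $(i,j)$ carries the label $\ell(j)$. It is self-looping if $(i,i)\in E$ for all $i\in S$. It is label-deterministic if for every $i\in S$, $a\in\Sigma$ there is at most one $j\in\mathrm{Out}(i)$ with $\ell(j)=a$. Put $\Sigma_i=\{\ell(j):j\in\mathrm{Out}(i)\}$ and, for $a\in\Sigma_i$, let $\delta(i,a)$ be the unique $j\in\mathrm{Out}(i)$ with $\ell(j)=a$. A symbolic DLSL (destination-labeled self-looping) system with dwell is $\mathcal A=(S,E,\ell,s_0,d,(g_i)_{i\in S})$ where $(S,E,\ell)$ is destination-labeled, self-looping and label-deterministic, $s_0\in S$, $d:S\to\mathbb N_{\ge1}$, $i\mapsto d_i$, and $g_i:\Omega\to\Sigma_i$ for each $i$. It is injectively labeled if $\ell$ is injective. Phase-expanded realization of $\mathcal A$: the deterministic transducer with control states $\{(i,r):i\in S,\ 0\le r\le d_i-1\}$, initial state $(s_0,d_{s_0}-1)$,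 transitions $\Delta((i,r),u)=(i,r-1)$ if $r>0$ and $\Delta((i,0),u)=(j,d_j-1)$ with $j=\delta(i,g_i(u))$, and visible labeling $\lambda(i,r)=i$; the symbol emitted on reading an input is the visible label of the successor state. A graph-respecting (labeled) transducer for a visible graph on $S$ (a directed graph, with out-neighborhoods $\mathrm{Out}(\cdot)$, not required to be self-looping) is a deterministic finite transducer $T=(Q,q_0,\Omega,S,\Delta,\lambda)$ with initial state $q_0$, $\Delta:Q\times\Omega\to Q$, $\lambda:Q\to S$ surjective, and $\lambda(\Delta(q,u))\in\mathrm{Out}(\lambda(q))$ for all $q\in Q$, $u\in\Omega$; it emits the visible label of the successor state. A state $q\in Q$ is forced-hold if there is $q'\in Q$ with $\lambda(q')=\lambda(q)$ and $\Delta(q,u)=q'$ for every $u\in\Omega$; then $\mathrm{hsucc}(q):=q'$. Otherwise $q$ is a decision state. For $i\in S$ let $\mathrm{Fib}(i)=\lambda^{-1}(i)$; the fiber hold graph $H_i$ has vertex set $\mathrm{Fib}(i)$ and an edge $q\to\mathrm{hsucc}(q)$ for each forced-hold $q\in\mathrm{Fib}(i)$. $T$ is fiber-linear if for every $i\in S$: (1) $H_i$ is a directed simple path on the whole of $\mathrm{Fib}(i)$, ending at a unique terminal vertex $p_i$; equivalently, $p_i$ is the unique decision state in $\mathrm{Fib}(i)$, every other state of $\mathrm{Fib}(i)$ is forced-hold, and repeated application of $\mathrm{hsucc}$ walks through the fiber in a single linear chain until $p_i$ is reached; (2) (reset-on-decision) with $t_i$ the unique initial vertex of the path $H_i$ (so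 $t_i=p_i$ when $|\mathrm{Fib}(i)|=1$), for every $u\in\Omega$, if $\lambda(\Delta(p_i,u))=j$ then $\Delta(p_i,u)=t_j$. Isomorphism of such transducers: a bijection of control-state sets that sends initial state to initial state, commutes with the transition maps for every input symbol, and preserves visible labels. The edge set $E$ of $\mathcal A_T$ is part of the data asserted to exist; in the construction of $\mathcal A_T$ it is $E=\{(i,j):\exists u\in\Omega,\ \lambda(\Delta(p_i,u))=j\}\cup\{(i,i):i\in S\}$, with $\ell(i)=i$, $d_i=|\mathrm{Fib}(i)|$, $g_i(u)=\lambda(\Delta(p_i,u))$. Injective relabeling means replacing the injective labeling $\ell$ by another injective labeling of the visible states, with the values of the maps $g_i$ renamed accordingly.
   Formalization: Assumes in addition that q_0 = t_{λ(q_0)} (existence fails otherwise); uniqueness up to injective relabeling covers ℓ, s_0, d, g_i, while E is only shown minimal, and unique among systems whose every non-loop edge is selected by some g_i, since idle edges do not affect the realization. *)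

theory Defs
  imports Main
begin

text \<open>
  The visible states form a finite type \<open>'s\<close>, the inputs a finite type \<open>'u\<close>, the edge labels a
  finite type \<open>'l\<close>. Control states carry an explicit finite set, because those of a phase-expanded
  realization are only some of the pairs in \<open>'s \<times> nat\<close>.
\<close>

record ('s, 'q, 'u) transducer =
  states :: "'q set"
  initial :: 'q
  step :: "'q \<Rightarrow> 'u \<Rightarrow> 'q"
  vis :: "'q \<Rightarrow> 's"

definition Out :: "('s \<times> 's) set \<Rightarrow> 's \<Rightarrow> 's set" where
  "Out E i = {j. (i, j) \<in> E}"

definition emit :: "('s, 'q, 'u) transducer \<Rightarrow> 'q \<Rightarrow> 'u \<Rightarrow> 's" where
  "emit T q u = vis T (step T q u)"

definition graph_respecting_transducer ::
  "('s::finite \<times> 's) set \<Rightarrow> ('s, 'q, 'u::finite) transducer \<Rightarrow> bool" where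
  "graph_respecting_transducer V T \<longleftrightarrow>
     finite (states T) \<and>
     initial T \<in> states T \<and>
     (\<forall>q\<in>states T. \<forall>u. step T q u \<in> states T) \<and>
     vis T ` states T = UNIV \<and>
     (\<forall>q\<in>states T. \<forall>u. emit T q u \<in> Out V (vis T q))"

definition transducer_iso ::
  "('s, 'q, 'u) transducer \<Rightarrow> ('s, 'r, 'u) transducer \<Rightarrow> bool" where
  "transducer_iso T T' \<longleftrightarrow>
     (\<exists>f. bij_betw f (states T) (states T') \<and>
          f (initial T) = initial T' \<and>
          (\<forall>q\<in>states T. \<forall>u. f (step T q u) = step T' (f q) u) \<and>
          (\<forall>q\<in>states T. vis T' (f q) = vis T q))"


subsection \<open>Fiber-linear transducers\<close>

definition hold_target :: "('s, 'q, 'u) transducer \<Rightarrow> 'q \<Rightarrow> 'q \<Rightarrow> bool" where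
  "hold_target T q q' \<longleftrightarrow>
     q' \<in> states T \<and> vis T q' = vis T q \<and> (\<forall>u. step T q u = q')"

definition forced_hold :: "('s, 'q, 'u) transducer \<Rightarrow> 'q \<Rightarrow> bool" where
  "forced_hold T q \<longleftrightarrow> (\<exists>q'. hold_target T q q')"

definition hsucc :: "('s, 'q, 'u) transducer \<Rightarrow> 'q \<Rightarrow> 'q" where
  "hsucc T q = (THE q'. hold_target T q q')"

definition Fib :: "('s, 'q, 'u) transducer \<Rightarrow> 's \<Rightarrow> 'q set" where
  "Fib T i = {q \<in> states T. vis T q = i}"

definition hold_graph :: "('s, 'q, 'u) transducer \<Rightarrow> 's \<Rightarrow> ('q \<times> 'q) set" where
  "hold_graph T i = {(q, hsucc T q) | q. q \<in> Fib T i \<and> forced_hold T q}"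

text \<open>The list enumerates all vertices in path order, and the graph has no edges off the path.\<close>

definition is_directed_simple_path :: "'q set \<Rightarrow> ('q \<times> 'q) set \<Rightarrow> bool" where
  "is_directed_simple_path W H \<longleftrightarrow>
     (\<exists>xs. xs \<noteq> [] \<and> distinct xs \<and> set xs = W \<and>
           H = {(xs ! k, xs ! Suc k) | k. Suc k < length xs})"

text \<open>
  The vertices $p_i$ and $t_i$ of the fiber of \<open>i\<close>; both descriptions are meaningful only when the
  hold graph of \<open>i\<close> is a path. A vertex without outgoing hold edge is exactly a decision state.
\<close>

definition terminal :: "('s, 'q, 'u) transducer \<Rightarrow> 's \<Rightarrow> 'q" where
  "terminal T i = (THE p. p \<in> Fib T i \<and> p \<notin> Domain (hold_graph T i))"

definition entry :: "('s, 'q, 'u) transducer \<Rightarrow> 's \<Rightarrow> 'q" where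
  "entry T i = (THE t. t \<in> Fib T i \<and> t \<notin> Range (hold_graph T i))"

definition fiber_linear :: "('s, 'q, 'u) transducer \<Rightarrow> bool" where
  "fiber_linear T \<longleftrightarrow>
     (\<forall>i. is_directed_simple_path (Fib T i) (hold_graph T i)) \<and>
     (\<forall>i u j. emit T (terminal T i) u = j \<longrightarrow> step T (terminal T i) u = entry T j)"


subsection \<open>Symbolic DLSL systems with dwell\<close>

record ('s, 'l, 'u) dlsl =
  edges :: "('s \<times> 's) set"
  label :: "'s \<Rightarrow> 'l"
  start :: 's
  dwell :: "'s \<Rightarrow> nat"
  guard :: "'s \<Rightarrow> 'u \<Rightarrow> 'l"

definition self_looping :: "('s \<times> 's) set \<Rightarrow> bool" where
  "self_looping E \<longleftrightarrow> (\<forall>i. (i, i) \<in> E)"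

definition label_deterministic :: "('s \<times> 's) set \<Rightarrow> ('s \<Rightarrow> 'l) \<Rightarrow> bool" where
  "label_deterministic E l \<longleftrightarrow> (\<forall>i a. \<exists>\<^sub>\<le>\<^sub>1 j. j \<in> Out E i \<and> l j = a)"

definition out_labels :: "('s, 'l, 'u) dlsl \<Rightarrow> 's \<Rightarrow> 'l set" where
  "out_labels A i = label A ` Out (edges A) i"

definition delta :: "('s, 'l, 'u) dlsl \<Rightarrow> 's \<Rightarrow> 'l \<Rightarrow> 's" where
  "delta A i a = (THE j. j \<in> Out (edges A) i \<and> label A j = a)"

definition dlsl_system :: "('s::finite, 'l::finite, 'u::finite) dlsl \<Rightarrow> bool" where
  "dlsl_system A \<longleftrightarrow>
     self_looping (edges A) \<and>
     label_deterministic (edges A) (label A) \<and>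
     (\<forall>i. dwell A i \<ge> 1) \<and>
     (\<forall>i u. guard A i u \<in> out_labels A i)"

definition injectively_labeled :: "('s, 'l, 'u) dlsl \<Rightarrow> bool" where
  "injectively_labeled A \<longleftrightarrow> inj (label A)"

definition realization :: "('s, 'l, 'u) dlsl \<Rightarrow> ('s, 's \<times> nat, 'u) transducer" where
  "realization A = \<lparr>
     states = {(i, r). r \<le> dwell A i - 1},
     initial = (start A, dwell A (start A) - 1),
     step = (\<lambda>(i, r) u.
       if r > 0 then (i, r - 1)
       else let j = delta A i (guard A i u) in (j, dwell A j - 1)),
     vis = fst \<rparr>"

text \<open>The two systems may use different label alphabets; the labels are renamed by \<open>\<rho>\<close>.\<close>

definition injective_relabeling :: "('s, 'l, 'u) dlsl \<Rightarrow> ('s, 'm, 'u) dlsl \<Rightarrow> bool" where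
  "injective_relabeling A B \<longleftrightarrow>
     edges B = edges A \<and> start B = start A \<and> dwell B = dwell A \<and>
     (\<exists>\<rho>. inj_on \<rho> (range (label A)) \<and>
          (\<forall>i. label B i = \<rho> (label A i)) \<and>
          (\<forall>i u. guard B i u = \<rho> (guard A i u)))"

text \<open>
  The realization does not see an edge that is neither a loop nor selected by a guard, so no
  uniqueness statement can control such edges.
\<close>

definition no_idle_edges :: "('s, 'l, 'u) dlsl \<Rightarrow> bool" where
  "no_idle_edges A \<longleftrightarrow>
     (\<forall>(i, j)\<in>edges A. i \<noteq> j \<longrightarrow> (\<exists>u. delta A i (guard A i u) = j))"

end

theory Submission
  imports Defs
begin

text \<open>
  Walking down the hold path of a fiber of size $d_i$ is the same as counting a dwell counter
  down from $d_i - 1$, so sending $(i, r)$ to the vertex of $H_i$ at distance $r$ from its end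
  is an isomorphism, and reset-on-decision makes it commute with the decision steps. Conversely,
  an isomorphism onto $T$ sends every $(i, r)$ with $r > 0$ to a forced-hold state, hence $(i, 0)$
  to the decision state $p_i$; the fiber sizes and the outputs at the $p_i$ then determine
  the dwell times and the guards.
\<close>

section \<open>Hold paths inside the fibers\<close>

lemma hsucc_eq_step:
  assumes "forced_hold T q"
  shows "hsucc T q = step T q u"
proof -
  from assms obtain q' where q': "hold_target T q q'"
    unfolding forced_hold_def by blast
  have "hsucc T q = q'"
    unfolding hsucc_def using q' by (rule the_equality) (use q' in \<open>auto simp: hold_target_def\<close>)
  with q' show ?thesis by (simp add: hold_target_def)
qed

text \<open>Every position but the last starts an edge, and distinctness keeps the last vertex from
  reappearing earlier. This evaluates the description operator in \<open>terminal\<close>; the next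
  lemma is its mirror image for \<open>entry\<close>.\<close>

lemma notin_Domain_path:
  assumes "xs \<noteq> []" "distinct xs"
  shows "p \<in> set xs \<and> p \<notin> Domain {(xs ! k, xs ! Suc k) | k. Suc k < length xs} \<longleftrightarrow> p = last xs"
proof
  assume p: "p \<in> set xs \<and> p \<notin> Domain {(xs ! k, xs ! Suc k) | k. Suc k < length xs}"
  then obtain k where k: "k < length xs" "p = xs ! k" by (auto simp: in_set_conv_nth)
  with p have "\<not> Suc k < length xs" by blast
  with k have "k = length xs - 1" by linarith
  with k assms show "p = last xs" by (simp add: last_conv_nth)
next
  assume p: "p = last xs"
  have "p \<noteq> xs ! k" if "Suc k < length xs" for k
    using p assms that by (auto simp: last_conv_nth nth_eq_iff_index_eq)
  with p assms show "p \<in> set xs \<and> p \<notin> Domain {(xs ! k, xs ! Suc k) | k. Suc k < length xs}"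
    by auto
qed

lemma notin_Range_path:
  assumes "xs \<noteq> []" "distinct xs"
  shows "p \<in> set xs \<and> p \<notin> Range {(xs ! k, xs ! Suc k) | k. Suc k < length xs} \<longleftrightarrow> p = xs ! 0"
proof
  assume p: "p \<in> set xs \<and> p \<notin> Range {(xs ! k, xs ! Suc k) | k. Suc k < length xs}"
  then obtain k where k: "k < length xs" "p = xs ! k" by (auto simp: in_set_conv_nth)
  with p have "k = 0" by (cases k) blast+
  with k show "p = xs ! 0" by simp
next
  assume p: "p = xs ! 0"
  have "p \<noteq> xs ! Suc k" if "Suc k < length xs" for k
  proof -
    have "0 < length xs" using that by linarith
    with p assms that show ?thesis by (simp add: nth_eq_iff_index_eq)
  qed
  with p assms show "p \<in> set xs \<and> p \<notin> Range {(xs ! k, xs ! Suc k) | k. Suc k < length xs}"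
    by auto
qed

text \<open>Trades the hold graph for a list along which a step moves one index. The path condition
  of \<open>fiber_linear\<close> is used later only in this form.\<close>

lemma fiber_path:
  assumes "fiber_linear T"
  shows "\<exists>xs. xs \<noteq> [] \<and> distinct xs \<and> set xs = Fib T i \<and>
    terminal T i = last xs \<and> entry T i = xs ! 0 \<and> \<not> forced_hold T (last xs) \<and>
    (\<forall>k u. Suc k < length xs \<longrightarrow> step T (xs ! k) u = xs ! Suc k)"
proof -
  from assms obtain xs where xs: "xs \<noteq> []" "distinct xs" and set: "set xs = Fib T i"
    and H: "hold_graph T i = {(xs ! k, xs ! Suc k) | k. Suc k < length xs}"
    unfolding fiber_linear_def is_directed_simple_path_def by blast
  have last: "p \<in> Fib T i \<and> p \<notin> Domain (hold_graph T i) \<longleftrightarrow> p = last xs" for p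
    using notin_Domain_path[OF xs, of p] by (simp only: set H)
  have first: "p \<in> Fib T i \<and> p \<notin> Range (hold_graph T i) \<longleftrightarrow> p = xs ! 0" for p
    using notin_Range_path[OF xs, of p] by (simp only: set H)
  have "step T (xs ! k) u = xs ! Suc k" if "Suc k < length xs" for k u
  proof -
    from that have "(xs ! k, xs ! Suc k) \<in> hold_graph T i" unfolding H by blast
    then have "forced_hold T (xs ! k)" "xs ! Suc k = hsucc T (xs ! k)"
      by (auto simp: hold_graph_def)
    then show ?thesis by (simp add: hsucc_eq_step[of T _ u])
  qed
  moreover have "\<not> forced_hold T (last xs)"
    using last[of "last xs"] by (auto simp: hold_graph_def)
  moreover have "terminal T i = last xs" "entry T i = xs ! 0"
    unfolding terminal_def entry_def by (simp_all add: last first)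
  ultimately show ?thesis using xs set by blast
qed

lemma terminal_in_Fib: "fiber_linear T \<Longrightarrow> terminal T i \<in> Fib T i"
  using fiber_path[of T i] by (metis last_in_set)

lemma not_forced_hold_terminal: "fiber_linear T \<Longrightarrow> \<not> forced_hold T (terminal T i)"
  using fiber_path[of T i] by metis

section \<open>Guard targets under an injective labeling\<close>

lemma delta_eqI:
  assumes "injectively_labeled A" "(i, j) \<in> edges A" "label A j = a"
  shows "delta A i a = j"
  unfolding delta_def
proof (rule the_equality)
  show "j \<in> Out (edges A) i \<and> label A j = a"
    using assms by (simp add: Out_def)
  show "\<And>k. k \<in> Out (edges A) i \<and> label A k = a \<Longrightarrow> k = j"
    using assms unfolding injectively_labeled_def by (metis injD)
qed

text \<open>Guards take values in \<open>out_labels\<close>, so a matching edge exists and the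
  description in \<open>delta\<close> is never arbitrary.\<close>

lemma delta_guard:
  assumes "dlsl_system A" "injectively_labeled A"
  shows "(i, delta A i (guard A i u)) \<in> edges A"
    and "label A (delta A i (guard A i u)) = guard A i u"
proof -
  have "guard A i u \<in> out_labels A i"
    using assms(1) by (simp add: dlsl_system_def)
  then obtain j where j: "(i, j) \<in> edges A" "label A j = guard A i u"
    unfolding out_labels_def Out_def by auto
  with delta_eqI[OF assms(2) j] show "(i, delta A i (guard A i u)) \<in> edges A"
    and "label A (delta A i (guard A i u)) = guard A i u" by simp_all
qed

section \<open>Existence: the system read off from the transducer\<close>

definition extracted_dlsl :: "('s, 'q, 'u) transducer \<Rightarrow> ('s, 's, 'u) dlsl" where
  "extracted_dlsl T = \<lparr>
     edges = {(i, j). \<exists>u. emit T (terminal T i) u = j} \<union> {(i, i) | i. True},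
     label = id,
     start = vis T (initial T),
     dwell = (\<lambda>i. card (Fib T i)),
     guard = (\<lambda>i. emit T (terminal T i)) \<rparr>"

lemma injectively_labeled_extracted_dlsl: "injectively_labeled (extracted_dlsl T)"
  by (simp add: injectively_labeled_def extracted_dlsl_def)

lemma delta_extracted_dlsl:
  "delta (extracted_dlsl T) i (guard (extracted_dlsl T) i u) = emit T (terminal T i) u"
  by (rule delta_eqI[OF injectively_labeled_extracted_dlsl]) (auto simp: extracted_dlsl_def)

lemma card_Fib_pos:
  assumes "fiber_linear T"
  shows "0 < card (Fib T i)"
  using fiber_path[OF assms, of i] by (metis List.finite_set card_gt_0_iff set_empty)

lemma dlsl_system_extracted_dlsl:
  fixes T :: "('s::finite, 'q, 'u::finite) transducer"
  assumes "fiber_linear T"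
  shows "dlsl_system (extracted_dlsl T)"
  using card_Fib_pos[OF assms]
  by (auto simp: dlsl_system_def extracted_dlsl_def self_looping_def label_deterministic_def
      out_labels_def Out_def Uniq_def Suc_le_eq)

text \<open>A realization starts with a full counter, which corresponds to the entry of a fiber;
  hence the second assumption on \<open>initial T\<close>.\<close>

lemma extracted_dlsl_realizes:
  fixes T :: "('s, 'q, 'u) transducer"
  assumes fl: "fiber_linear T"
    and init: "initial T \<in> states T" "initial T = entry T (vis T (initial T))"
  shows "transducer_iso (realization (extracted_dlsl T)) T"
proof -
  let ?R = "realization (extracted_dlsl T)"
  obtain P where P: "\<And>i. P i \<noteq> []" "\<And>i. distinct (P i)" "\<And>i. set (P i) = Fib T i"
    "\<And>i. terminal T i = last (P i)" "\<And>i. entry T i = P i ! 0"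
    and hold: "\<And>i k u. Suc k < length (P i) \<Longrightarrow> step T (P i ! k) u = P i ! Suc k"
    using fiber_path[OF fl] by metis
  have len: "card (Fib T i) = length (P i)" for i
    using P(2,3) by (metis distinct_card)
  have states: "states ?R = {(i, r). r < length (P i)}"
  proof -
    \<comment> \<open>Truncated subtraction is harmless because the paths are nonempty.\<close>
    have "r \<le> length (P i) - 1 \<longleftrightarrow> r < length (P i)" for i r
      using P(1)[of i] by (cases "P i") auto
    then show ?thesis by (simp add: realization_def extracted_dlsl_def len)
  qed
  \<comment> \<open>The index is reversed: \<open>P i\<close> runs from entry to terminal while the
    counter runs down to 0.\<close>
  define f where "f = (\<lambda>(i, r). P i ! (length (P i) - 1 - r))"
  have f_Fib: "f (i, r) \<in> Fib T i" if "r < length (P i)" for i r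
    unfolding f_def using that by (simp flip: P(3))
  have f_entry: "f (i, length (P i) - 1) = entry T i" for i
    by (simp add: f_def P(5))
  have bij: "bij_betw f (states ?R) (states T)"
  proof (rule bij_betw_imageI)
    show "inj_on f (states ?R)"
    proof (rule inj_onI, clarsimp simp: states)
      fix i r j s
      assume *: "r < length (P i)" "s < length (P j)" "f (i, r) = f (j, s)"
      \<comment> \<open>Fibers of different states are disjoint; within one fiber, distinctness of
        the path separates counters.\<close>
      with f_Fib[of r i] f_Fib[of s j] have "i = j" by (simp add: Fib_def)
      with * P(2) show "i = j \<and> r = s"
        by (auto simp: f_def nth_eq_iff_index_eq)
    qed
    show "f ` states ?R = states T"
    proof (rule equalityI; rule subsetI)
      fix q assume "q \<in> f ` states ?R"
      with f_Fib show "q \<in> states T" by (auto simp: states Fib_def)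
    next
      fix q assume "q \<in> states T"
      then have "q \<in> set (P (vis T q))" by (simp add: P(3) Fib_def)
      then obtain k where k: "k < length (P (vis T q))" "P (vis T q) ! k = q"
        by (auto simp: in_set_conv_nth)
      then have "f (vis T q, length (P (vis T q)) - 1 - k) = q"
        by (simp add: f_def)
      moreover have "(vis T q, length (P (vis T q)) - 1 - k) \<in> states ?R"
        using k by (simp add: states)
      ultimately show "q \<in> f ` states ?R" by (metis imageI)
    qed
  qed
  have "f (initial ?R) = initial T"
    using init f_entry[of "vis T (initial T)"]
    by (simp add: realization_def extracted_dlsl_def len)
  moreover have "f (step ?R q u) = step T (f q) u" if "q \<in> states ?R" for q u
  proof -
    obtain i r where q: "q = (i, r)" by force
    with that have r: "r < length (P i)" by (simp add: states)
    show ?thesis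
    proof (cases r)
      case 0
      \<comment> \<open>Counter 0 sits at the decision state, where reset-on-decision applies; the
        entry reached is the image of a full counter.\<close>
      have "step T (f q) u = entry T (emit T (terminal T i) u)"
      proof -
        have "f q = terminal T i"
          using P(1)[of i] by (simp add: q 0 f_def P(4) last_conv_nth)
        with fl show ?thesis by (simp add: fiber_linear_def)
      qed
      moreover have "step ?R q u =
          (emit T (terminal T i) u, length (P (emit T (terminal T i) u)) - 1)"
        \<comment> \<open>The \<open>delta\<close> term is rewritten while
          \<open>extracted_dlsl\<close> is still folded; the dwell is unfolded afterwards.\<close>
        using delta_extracted_dlsl[of T i u]
        by (simp add: q 0 realization_def Let_def) (simp add: extracted_dlsl_def len)
      ultimately show ?thesis by (simp only: f_entry)
    next
      case (Suc s)
      with r hold[of "length (P i) - 1 - r" i u] show ?thesis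
        by (simp add: q f_def realization_def Suc_diff_Suc)
    qed
  qed
  moreover have "vis T (f q) = vis ?R q" if "q \<in> states ?R" for q
  proof -
    obtain i r where q: "q = (i, r)" by force
    with that f_Fib[of r i] have "vis T (f q) = i" by (simp add: states Fib_def)
    then show ?thesis by (simp add: q realization_def)
  qed
  ultimately show ?thesis
    unfolding transducer_iso_def using bij by blast
qed

section \<open>Uniqueness: data recovered from the realization\<close>

lemma realization_iso_determines:
  fixes T :: "('s::finite, 'q, 'u::finite) transducer" and A :: "('s, 'l::finite, 'u) dlsl"
  assumes fl: "fiber_linear T"
    and sys: "dlsl_system A" "injectively_labeled A"
    and iso: "transducer_iso (realization A) T"
  shows "start A = vis T (initial T)"
    and "dwell A i = card (Fib T i)"
    and "delta A i (guard A i u) = emit T (terminal T i) u"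
proof -
  let ?R = "realization A"
  have dw: "dwell A k \<ge> 1" for k using sys(1) by (simp add: dlsl_system_def)
  have states: "(k, r) \<in> states ?R \<longleftrightarrow> r < dwell A k" for k r
    using dw[of k] by (auto simp: realization_def)
  obtain f where bij: "bij_betw f (states ?R) (states T)"
    and f_init: "f (initial ?R) = initial T"
    and f_step: "\<And>q u. q \<in> states ?R \<Longrightarrow> f (step ?R q u) = step T (f q) u"
    and f_vis: "\<And>q. q \<in> states ?R \<Longrightarrow> vis T (f q) = vis ?R q"
    using iso unfolding transducer_iso_def by blast
  have vis_R: "vis ?R (k, r) = k" for k r by (simp add: realization_def)
  have "initial ?R \<in> states ?R" by (simp add: realization_def)
  then have "vis T (initial T) = vis ?R (initial ?R)" using f_vis f_init by metis
  then show "start A = vis T (initial T)" by (simp add: realization_def)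
  \<comment> \<open>Preservation of visible labels carries each column of counters onto a fiber, so
    dwell times become cardinalities.\<close>
  have Fib: "Fib T i = f ` ({i} \<times> {..<dwell A i})"
  proof (rule equalityI; rule subsetI)
    fix q assume "q \<in> Fib T i"
    then have q: "q \<in> states T" "vis T q = i" by (auto simp: Fib_def)
    then obtain p where p: "p \<in> states ?R" "f p = q"
      using bij by (metis bij_betw_imp_surj_on imageE)
    with q f_vis have "vis ?R p = i" by metis
    with p states show "q \<in> f ` ({i} \<times> {..<dwell A i})"
      by (cases p) (auto simp: vis_R)
  next
    fix q assume "q \<in> f ` ({i} \<times> {..<dwell A i})"
    then obtain r where "(i, r) \<in> states ?R" "q = f (i, r)" by (auto simp: states)
    then show "q \<in> Fib T i"
      using bij_betwE[OF bij] f_vis by (simp add: Fib_def vis_R)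
  qed
  moreover have "inj_on f ({i} \<times> {..<dwell A i})"
    using bij by (rule inj_on_subset[OF bij_betw_imp_inj_on]) (auto simp: states)
  ultimately show "dwell A i = card (Fib T i)"
    by (simp add: card_image card_cartesian_product)
  have zero: "(i, 0) \<in> states ?R" using dw[of i] by (simp add: states)
  obtain r where r: "r < dwell A i" "terminal T i = f (i, r)"
    using terminal_in_Fib[OF fl, of i] unfolding Fib by auto
  \<comment> \<open>A positive counter ignores the input and keeps the visible state, so its image
    is forced-hold, unlike the terminal state.\<close>
  have "r = 0"
  proof (rule ccontr)
    assume "r \<noteq> 0"
    then have "step ?R (i, r) v = (i, r - 1)" for v by (simp add: realization_def)
    then have "step T (f (i, r)) v = f (i, r - 1)" for v
      using f_step[of "(i, r)" v] r by (simp add: states)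
    moreover have "f (i, r - 1) \<in> states T" "vis T (f (i, r - 1)) = vis T (f (i, r))"
      using bij_betwE[OF bij] f_vis[of "(i, r)"] f_vis[of "(i, r - 1)"] r
      by (auto simp: states vis_R)
    ultimately have "forced_hold T (f (i, r))"
      unfolding forced_hold_def hold_target_def by blast
    with not_forced_hold_terminal[OF fl, of i] r show False by simp
  qed
  with r have "step T (terminal T i) u = f (step ?R (i, 0) u)"
    using f_step[OF zero] by simp
  moreover have "step ?R (i, 0) u \<in> states ?R" "vis ?R (step ?R (i, 0) u) = delta A i (guard A i u)"
    by (simp_all add: realization_def Let_def)
  ultimately show "delta A i (guard A i u) = emit T (terminal T i) u"
    using f_vis unfolding emit_def by metis
qed

text \<open>The assumption on \<open>initial T\<close> is forced: any isomorphism sends the full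
  counter of the start state to the entry of its fiber. The realization bounds the edges of
  \<open>A'\<close> only from below, so relabeling is claimed after overwriting them, or in the
  absence of idle edges.\<close>

theorem theorem5p6:
  fixes V :: "('s::finite \<times> 's) set"
    and T :: "('s, 'q, 'u::finite) transducer"
  assumes "graph_respecting_transducer V T"
    and "fiber_linear T"
    and "initial T = entry T (vis T (initial T))"
  shows "\<exists>A :: ('s, 's, 'u) dlsl.
    dlsl_system A \<and> injectively_labeled A \<and>
    transducer_iso (realization A) T \<and>
    edges A = {(i, j). \<exists>u. emit T (terminal T i) u = j} \<union> {(i, i) | i. True} \<and>
    (\<forall>A' :: ('s, 'l::finite, 'u) dlsl.
       dlsl_system A' \<and> injectively_labeled A' \<and> transducer_iso (realization A') T \<longrightarrow>
         edges A \<subseteq> edges A' \<and>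
         injective_relabeling A (A'\<lparr>edges := edges A\<rparr>) \<and>
         (no_idle_edges A' \<longrightarrow> injective_relabeling A A'))"
proof -
  let ?A = "extracted_dlsl T"
  have edges_A: "edges ?A = {(i, j). \<exists>u. emit T (terminal T i) u = j} \<union> {(i, i) | i. True}"
    by (simp add: extracted_dlsl_def)
  have "transducer_iso (realization ?A) T"
    using assms by (intro extracted_dlsl_realizes) (auto simp: graph_respecting_transducer_def)
  moreover have "edges ?A \<subseteq> edges A' \<and> injective_relabeling ?A (A'\<lparr>edges := edges ?A\<rparr>) \<and>
      (no_idle_edges A' \<longrightarrow> injective_relabeling ?A A')"
    if sys: "dlsl_system A'" "injectively_labeled A'" and iso: "transducer_iso (realization A') T"
    for A' :: "('s, 'l, 'u) dlsl"
  proof -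
    note det = realization_iso_determines[OF assms(2) sys iso]
    \<comment> \<open>With targets replaced by outputs of \<open>T\<close>, this says that each
      output is an edge target of \<open>A'\<close> and that its label is the guard value.\<close>
    note guard = delta_guard[OF sys, unfolded det(3)]
    have loops: "(i, i) \<in> edges A'" for i
      using sys(1) by (simp add: dlsl_system_def self_looping_def)
    have sub: "edges ?A \<subseteq> edges A'"
      using guard(1) loops by (auto simp: edges_A)
    \<comment> \<open>States label themselves in \<open>?A\<close>, so the renaming is
      \<open>label A'\<close> itself.\<close>
    have rel: "injective_relabeling ?A (A'\<lparr>edges := edges ?A\<rparr>)"
      using sys(2) guard(2) det(1,2)
      by (auto simp: injective_relabeling_def extracted_dlsl_def injectively_labeled_def
          intro!: exI[of _ "label A'"])
    have "injective_relabeling ?A A'" if "no_idle_edges A'"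
    proof -
      have "edges A' \<subseteq> edges ?A"
        using that by (auto simp: no_idle_edges_def edges_A det(3))
      with sub have "edges A' = edges ?A" by blast
      then have "A'\<lparr>edges := edges ?A\<rparr> = A'" by (cases A') simp
      with rel show ?thesis by simp
    qed
    with sub rel show ?thesis by blast
  qed
  ultimately show ?thesis
    using dlsl_system_extracted_dlsl[OF assms(2)] injectively_labeled_extracted_dlsl edges_A
    by blast
qed

end
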